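(* Let $X$ be an infinite-dimensional real Banach space and let $S_X=\{x\in X:\|x\|=1\}$ be its unit sphere, with the metric induced by the norm of $X$. Then the Lipschitz-free space $\mathcal{F}(S_X)$ is linearly isomorphic to a complemented subspace of the Lipschitz-free space $\mathcal{F}(X)$.
   Context: "Isomorphic" for Banach spaces means that there is a bounded linear bijection with bounded inverse (not necessarily isometric). A complemented subspace of a Banach space is a closed subspace that is the range of a bounded linear projection. Lipschitz-free space: for a metric space $M$ with a distinguished base point $0\in M$, $\mathrm{Lip}_0(M)$ is the Banach space of all real-valued Lipschitz functions $f$ on $M$ with $f(0)=0$, normed by the Lipschitz constant. For $x\in M$, let $\delta(x)\in \mathrm{Lip}_0(M)^*$ be the evaluation functional $\delta(x)(f)=f(x)$. The Lipschitz-free space $\mathcal{F}(M)$ is the norm-closed linear span of $\{\delta(x):x\in M\}$ in $\mathrm{Lip}_0(M)^*$. A different choice of base point gives an isometrically isomorphic space, so the base point of $S_X$ may be any of its points. *)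

theory Defs
  imports "HOL-Analysis.Analysis" "HOL-Library.Function_Algebras"
begin

text \<open>
  Addition on functions is pointwise (HOL-Library.Function_Algebras); with pointwise scalar
  multiplication, sets of real functions and of functionals on them live in a
  \<^class>\<open>real_vector\<close> type, so that \<^const>\<open>span\<close> and \<^const>\<open>subspace\<close> apply to them.
\<close>

instantiation "fun" :: (type, real_vector) real_vector
begin

definition scaleR_fun :: "real \<Rightarrow> ('a \<Rightarrow> 'b) \<Rightarrow> 'a \<Rightarrow> 'b"
  where "scaleR_fun c f = (\<lambda>x. c *\<^sub>R f x)"

instance
  by standard (simp_all add: scaleR_fun_def plus_fun_def fun_eq_iff scaleR_add_right scaleR_add_left)

end

text \<open>
  A normed space is given below by its carrier, a linear subspace \<open>V\<close> of a
  \<^class>\<open>real_vector\<close> type, together with a norm function \<open>n\<close> that matters on \<open>V\<close> only.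
\<close>

definition bounded_linear_on ::
    "'v::real_vector set \<Rightarrow> ('v \<Rightarrow> real) \<Rightarrow> 'w::real_vector set \<Rightarrow> ('w \<Rightarrow> real) \<Rightarrow> ('v \<Rightarrow> 'w) \<Rightarrow> bool"
  where "bounded_linear_on V n W m T \<longleftrightarrow>
    (\<forall>x\<in>V. T x \<in> W) \<and>
    (\<forall>x\<in>V. \<forall>y\<in>V. T (x + y) = T x + T y) \<and>
    (\<forall>c. \<forall>x\<in>V. T (c *\<^sub>R x) = c *\<^sub>R T x) \<and>
    (\<exists>K. \<forall>x\<in>V. m (T x) \<le> K * n x)"

definition isomorphic_normed ::
    "'v::real_vector set \<Rightarrow> ('v \<Rightarrow> real) \<Rightarrow> 'w::real_vector set \<Rightarrow> ('w \<Rightarrow> real) \<Rightarrow> bool"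
  where "isomorphic_normed V n W m \<longleftrightarrow>
    (\<exists>T. bij_betw T V W \<and> bounded_linear_on V n W m T \<and> bounded_linear_on W m V n (inv_into V T))"

definition closed_subspace_of ::
    "'v::real_vector set \<Rightarrow> 'v set \<Rightarrow> ('v \<Rightarrow> real) \<Rightarrow> bool"
  where "closed_subspace_of Y V n \<longleftrightarrow>
    subspace Y \<and> Y \<subseteq> V \<and> (\<forall>x\<in>V. (\<forall>e>0. \<exists>y\<in>Y. n (x - y) < e) \<longrightarrow> x \<in> Y)"

definition complemented_subspace_of ::
    "'v::real_vector set \<Rightarrow> 'v set \<Rightarrow> ('v \<Rightarrow> real) \<Rightarrow> bool"
  where "complemented_subspace_of Y V n \<longleftrightarrow>
    closed_subspace_of Y V n \<and>
    (\<exists>P. bounded_linear_on V n V n P \<and> (\<forall>x\<in>V. P (P x) = P x) \<and> P ` V = Y)"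

text \<open>
  Elements of the dual are total functions, normalised to be \<open>0\<close> outside the carrier \<open>V\<close>, so that
  equality of functionals on \<open>V\<close> is equality.
\<close>

definition continuous_dual :: "'v::real_vector set \<Rightarrow> ('v \<Rightarrow> real) \<Rightarrow> ('v \<Rightarrow> real) set"
  where "continuous_dual V n = {\<phi>. bounded_linear_on V n UNIV norm \<phi> \<and> (\<forall>f. f \<notin> V \<longrightarrow> \<phi> f = 0)}"

definition dual_norm :: "'v::real_vector set \<Rightarrow> ('v \<Rightarrow> real) \<Rightarrow> ('v \<Rightarrow> real) \<Rightarrow> real"
  where "dual_norm V n \<phi> = (SUP f\<in>{f\<in>V. n f \<le> 1}. \<bar>\<phi> f\<bar>)"

text \<open>
  In the following, \<open>M\<close> is a metric space, given as a subset of a \<^class>\<open>metric_space\<close> type, and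
  \<open>p \<in> M\<close> its base point. Functions on \<open>M\<close> are extended by \<open>0\<close> outside \<open>M\<close>.
\<close>

definition lip0 :: "'a::metric_space set \<Rightarrow> 'a \<Rightarrow> ('a \<Rightarrow> real) set"
  where "lip0 M p = {f. (\<exists>C. C-lipschitz_on M f) \<and> f p = 0 \<and> (\<forall>x. x \<notin> M \<longrightarrow> f x = 0)}"

definition lip_const :: "'a::metric_space set \<Rightarrow> ('a \<Rightarrow> real) \<Rightarrow> real"
  where "lip_const M f = Inf {C. C-lipschitz_on M f}"

definition free_norm :: "'a::metric_space set \<Rightarrow> 'a \<Rightarrow> (('a \<Rightarrow> real) \<Rightarrow> real) \<Rightarrow> real"
  where "free_norm M p = dual_norm (lip0 M p) (lip_const M)"

definition point_eval :: "'a::metric_space set \<Rightarrow> 'a \<Rightarrow> 'a \<Rightarrow> ('a \<Rightarrow> real) \<Rightarrow> real"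
  where "point_eval M p x = (\<lambda>f. if f \<in> lip0 M p then f x else 0)"

definition lipschitz_free :: "'a::metric_space set \<Rightarrow> 'a \<Rightarrow> (('a \<Rightarrow> real) \<Rightarrow> real) set"
  where "lipschitz_free M p =
    {\<phi> \<in> continuous_dual (lip0 M p) (lip_const M).
      \<forall>e>0. \<exists>\<psi>\<in>span (point_eval M p ` M). free_norm M p (\<phi> - \<psi>) < e}"

end

(*
  The positively homogeneous extension (Ef)(x) = ||x|| f(x / ||x||) is a bounded linear right
  inverse of the restriction Lip_0(X) \<rightarrow> Lip_0(S_X), up to the constants that adjust base points.
  Its adjoint sends the evaluation at x to ||x|| times the evaluation at x / ||x||, hence maps
  F(X) to F(S_X), and it is a left inverse of the canonical map F(S_X) \<rightarrow> F(X). A bounded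
  linear map with a bounded linear left inverse is an isomorphism onto a complemented subspace.
*)
theory Submission
  imports Defs
begin

section \<open>Normed spaces given by a carrier\<close>

text \<open>Homogeneity is asked as an inequality, the form in which it is checked for
  \<open>lip_const\<close> and \<open>dual_norm\<close>; equality follows by scaling back.
  Nonnegativity follows from the triangle inequality for x and -x.\<close>

locale normed_carrier =
  fixes V :: "'v::real_vector set" and n :: "'v \<Rightarrow> real"
  assumes subspace: "subspace V"
    and triangle: "\<lbrakk>x \<in> V; y \<in> V\<rbrakk> \<Longrightarrow> n (x + y) \<le> n x + n y"
    and scale_le: "x \<in> V \<Longrightarrow> n (c *\<^sub>R x) \<le> \<bar>c\<bar> * n x"
    and definite: "\<lbrakk>x \<in> V; n x = 0\<rbrakk> \<Longrightarrow> x = 0"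
begin

lemma zero_mem: "0 \<in> V"
  using subspace by (rule subspace_0)

lemma norm_zero: "n 0 = 0"
  using scale_le[OF zero_mem, of 0] triangle[OF zero_mem zero_mem] by simp

lemma norm_uminus_le: "x \<in> V \<Longrightarrow> n (- x) \<le> n x"
  using scale_le[of x "-1"] by simp

lemma norm_nonneg:
  assumes "x \<in> V"
  shows "0 \<le> n x"
  using triangle[OF assms subspace_neg[OF subspace assms]] norm_uminus_le[OF assms] norm_zero
  by simp

lemma triangle_diff:
  assumes "x \<in> V" "y \<in> V"
  shows "n (x - y) \<le> n x + n y"
  using triangle[OF assms(1) subspace_neg[OF subspace assms(2)]] norm_uminus_le[OF assms(2)]
  by simp

text \<open>Used to show that a limit of points of a range is fixed by the projection: there x is
  the defect of the fixed point equation.\<close>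

lemma zero_if_arbitrarily_small:
  assumes "x \<in> V" and small: "\<And>e. e > 0 \<Longrightarrow> n x \<le> K * e"
  shows "x = 0"
proof -
  have "n x \<le> 0"
  proof (rule field_le_epsilon)
    fix e :: real assume e: "e > 0"
    \<comment> \<open>K may be zero or negative, so the scaling uses
      \<open>\<bar>K\<bar> + 1\<close>, which is always positive.\<close>
    have "n x \<le> K * (e / (\<bar>K\<bar> + 1))"
      using e by (intro small) simp
    also have "\<dots> \<le> \<bar>K\<bar> * (e / (\<bar>K\<bar> + 1))"
      using e by (intro mult_right_mono) auto
    also have "\<dots> \<le> 0 + e"
      using e by (simp add: field_simps)
    finally show "n x \<le> 0 + e" .
  qed
  then show ?thesis
    using assms(1) norm_nonneg definite by fastforce
qed

end

section \<open>Bounded linear maps between carriers\<close>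

lemma bounded_linear_on_bound_nonneg:
  assumes "normed_carrier V n" "bounded_linear_on V n W m T"
  obtains K where "K \<ge> 0" "\<And>x. x \<in> V \<Longrightarrow> m (T x) \<le> K * n x"
proof -
  interpret normed_carrier V n by fact
  obtain K where K: "\<And>x. x \<in> V \<Longrightarrow> m (T x) \<le> K * n x"
    using assms(2) unfolding bounded_linear_on_def by blast
  \<comment> \<open>The definition of boundedness leaves the sign of K open; since n is nonnegative
    on V, passing to the absolute value only weakens the bound.\<close>
  have "m (T x) \<le> \<bar>K\<bar> * n x" if "x \<in> V" for x
    using K[OF that] mult_right_mono[OF abs_ge_self[of K] norm_nonneg[OF that]] by linarith
  then show ?thesis
    using that[of "\<bar>K\<bar>"] by simp
qed

lemma bounded_linear_on_compose:
  assumes "normed_carrier W m"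
    and T: "bounded_linear_on V n W m T" and S: "bounded_linear_on W m U l S"
  shows "bounded_linear_on V n U l (S \<circ> T)"
proof -
  obtain K where "\<And>x. x \<in> V \<Longrightarrow> m (T x) \<le> K * n x"
    using T unfolding bounded_linear_on_def by blast
  moreover obtain L where "L \<ge> 0" "\<And>y. y \<in> W \<Longrightarrow> l (S y) \<le> L * m y"
    using bounded_linear_on_bound_nonneg[OF assms(1) S] by blast
  moreover have "\<And>x. x \<in> V \<Longrightarrow> T x \<in> W"
    using T unfolding bounded_linear_on_def by blast
  ultimately have "l ((S \<circ> T) x) \<le> (L * K) * n x" if "x \<in> V" for x
    using that mult_left_mono[of "m (T x)" "K * n x" L] by (fastforce simp: mult.assoc)
  then show ?thesis
    using T S unfolding bounded_linear_on_def by auto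
qed

lemma bounded_linear_on_subset:
  assumes "bounded_linear_on V n W m T" "V' \<subseteq> V"
  shows "bounded_linear_on V' n W m T"
  using assms unfolding bounded_linear_on_def by (meson subsetD)

lemma bounded_linear_on_restrict:
  assumes "bounded_linear_on V n W m T" "T ` V \<subseteq> W'"
  shows "bounded_linear_on V n W' m T"
  using assms unfolding bounded_linear_on_def by blast

text \<open>Allows \<open>inv_into V T\<close> to be replaced by an explicit left inverse that
  agrees with it on the carrier only.\<close>

lemma bounded_linear_on_cong:
  assumes "bounded_linear_on V n W m T" "subspace V" "\<And>x. x \<in> V \<Longrightarrow> T x = T' x"
  shows "bounded_linear_on V n W m T'"
proof -
  have "T' (x + y) = T' x + T' y" "T' (c *\<^sub>R x) = c *\<^sub>R T' x" if "x \<in> V" "y \<in> V" for x y c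
    using assms that subspace_add[OF assms(2)] subspace_scale[OF assms(2)]
    unfolding bounded_linear_on_def by metis+
  then show ?thesis
    using assms unfolding bounded_linear_on_def by metis
qed

lemma bounded_linear_on_diff:
  assumes "bounded_linear_on V n W m T" "subspace V" "x \<in> V" "y \<in> V"
  shows "T (x - y) = T x - T y"
proof -
  have "T (x - y) + T y = T x"
    using assms subspace_diff[OF assms(2-4)] unfolding bounded_linear_on_def
    by (metis diff_add_cancel)
  then show ?thesis
    by (simp add: algebra_simps)
qed

lemma subspace_bounded_linear_image:
  assumes T: "bounded_linear_on V n W m T" and V: "subspace V"
  shows "subspace (T ` V)"
proof (rule subspaceI)
  \<comment> \<open>T is linear on the carrier only, so T 0 = 0 is read off from homogeneity with c
    = 0.\<close>
  have "T (0 *\<^sub>R 0) = 0 *\<^sub>R T 0"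
    using T subspace_0[OF V] unfolding bounded_linear_on_def by blast
  then show "0 \<in> T ` V"
    using subspace_0[OF V] by (simp add: image_iff) metis
next
  fix u v assume "u \<in> T ` V" "v \<in> T ` V"
  then obtain x y where xy: "x \<in> V" "y \<in> V" and uv: "u = T x" "v = T y"
    by blast
  have "u + v = T (x + y)"
    using T xy unfolding uv bounded_linear_on_def by simp
  then show "u + v \<in> T ` V"
    using subspace_add[OF V xy] by blast
next
  fix c u assume "u \<in> T ` V"
  then obtain x where x: "x \<in> V" and u: "u = T x"
    by blast
  have "c *\<^sub>R u = T (c *\<^sub>R x)"
    using T x unfolding u bounded_linear_on_def by simp
  then show "c *\<^sub>R u \<in> T ` V"
    using subspace_scale[OF V x] by blast
qed

text \<open>Since Q T is the identity on V, P = T Q is a bounded idempotent with range T(V). This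
  range is the set of fixed points of P, hence closed by continuity.\<close>

lemma complemented_of_left_inverse:
  assumes V: "normed_carrier V n" and W: "normed_carrier W m"
    and T: "bounded_linear_on V n W m T" and Q: "bounded_linear_on W m V n Q"
    and QT: "\<And>x. x \<in> V \<Longrightarrow> Q (T x) = x"
  shows "complemented_subspace_of (T ` V) W m" and "isomorphic_normed V n (T ` V) m"
proof -
  interpret V: normed_carrier V n by fact
  interpret W: normed_carrier W m by fact
  have TV: "T ` V \<subseteq> W" and QW: "Q ` W \<subseteq> V"
    using T Q unfolding bounded_linear_on_def by auto
  have sub: "subspace (T ` V)"
    using subspace_bounded_linear_image[OF T V.subspace] .
  let ?P = "T \<circ> Q"
  have P: "bounded_linear_on W m W m ?P"
    using bounded_linear_on_compose[OF V Q T] .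
  obtain K where K: "\<And>x. x \<in> W \<Longrightarrow> m (?P x) \<le> K * m x" "K \<ge> 0"
    using bounded_linear_on_bound_nonneg[OF W P] by blast
  have closed: "x \<in> T ` V" if x: "x \<in> W" and approx: "\<forall>e>0. \<exists>y\<in>T ` V. m (x - y) < e" for x
  proof -
    have Px: "?P x \<in> W"
      using x TV QW by auto
    have "m (?P x - x) \<le> (K + 1) * e" if e: "e > 0" for e
    proof -
      obtain y where y: "y \<in> T ` V" "m (x - y) < e"
        using approx e by blast
      have xy: "x - y \<in> W"
        using x y TV subspace_diff[OF W.subspace] by blast
      \<comment> \<open>P fixes y because y lies in the range of T; so the defect of x is controlled
        by the distance from x to y.\<close>
      have "?P x - x = ?P (x - y) - (x - y)"
        using bounded_linear_on_diff[OF P W.subspace, of x y] x y TV QT by auto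
      also have "m \<dots> \<le> m (?P (x - y)) + m (x - y)"
        using W.triangle_diff[of "?P (x - y)" "x - y"] xy TV QW by fastforce
      also have "\<dots> \<le> (K + 1) * m (x - y)"
        using K(1)[OF xy] by (simp add: algebra_simps)
      also have "\<dots> \<le> (K + 1) * e"
        using y(2) K(2) by (intro mult_left_mono) auto
      finally show ?thesis .
    qed
    then have "?P x - x = 0"
      using W.zero_if_arbitrarily_small subspace_diff[OF W.subspace Px x] by blast
    then show ?thesis
      using x QW by (metis comp_apply eq_iff_diff_eq_0 imageI image_subset_iff)
  qed
  have "?P ` W = T ` V"
    using TV QW QT by (force simp: image_iff)
  moreover have "?P (?P x) = ?P x" if "x \<in> W" for x
    using QT QW that by auto
  ultimately show "complemented_subspace_of (T ` V) W m"
    unfolding complemented_subspace_of_def closed_subspace_of_def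
    using P sub TV closed by metis
  have inj: "inj_on T V"
    using QT by (rule inj_on_inverseI)
  \<comment> \<open>On the range of T the inverse coincides with Q and inherits its bound.\<close>
  have "bounded_linear_on (T ` V) m V n (inv_into V T)"
    using bounded_linear_on_subset[OF Q TV] sub
    by (rule bounded_linear_on_cong) (auto simp: QT inv_into_f_f[OF inj])
  then show "isomorphic_normed V n (T ` V) m"
    unfolding isomorphic_normed_def
    using inj_on_imp_bij_betw[OF inj] bounded_linear_on_restrict[OF T] by blast
qed

section \<open>Dual spaces and adjoints\<close>

context normed_carrier
begin

text \<open>Normalise f to norm 1 and compare with the supremum over the unit ball; vectors of norm
  zero are treated apart, by the bound K.\<close>

lemma dual_norm_upper:
  assumes "\<phi> \<in> continuous_dual V n" "f \<in> V"
  shows "\<bar>\<phi> f\<bar> \<le> dual_norm V n \<phi> * n f"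
proof -
  have "bounded_linear_on V n UNIV norm \<phi>"
    using assms(1) by (simp add: continuous_dual_def)
  then obtain K where K: "K \<ge> 0" "\<And>x. x \<in> V \<Longrightarrow> norm (\<phi> x) \<le> K * n x"
    using bounded_linear_on_bound_nonneg[OF normed_carrier_axioms] by blast
  have scale: "\<phi> (c *\<^sub>R x) = c * \<phi> x" if "x \<in> V" for c x
    using assms that by (auto simp: continuous_dual_def bounded_linear_on_def)
  \<comment> \<open>A real \<open>SUP\<close> is an upper bound only for a set that is bounded
    above.\<close>
  have bdd: "bdd_above ((\<lambda>f. \<bar>\<phi> f\<bar>) ` {f \<in> V. n f \<le> 1})"
  proof (rule bdd_aboveI2)
    fix x assume "x \<in> {f \<in> V. n f \<le> 1}"
    then show "\<bar>\<phi> x\<bar> \<le> K"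
      using K(2)[of x] mult_left_mono[of "n x" 1 K] K(1) by auto
  qed
  show ?thesis
  proof (cases "n f = 0")
    case True
    then show ?thesis
      using K(2)[OF assms(2)] by simp
  next
    case False
    then have pos: "n f > 0"
      using norm_nonneg[OF assms(2)] by simp
    define g where "g = inverse (n f) *\<^sub>R f"
    have "g \<in> V"
      using assms subspace by (simp add: g_def subspace_scale)
    moreover have "n g \<le> 1"
      using scale_le[OF assms(2), of "inverse (n f)"] pos by (simp add: g_def)
    ultimately have "\<bar>\<phi> g\<bar> \<le> dual_norm V n \<phi>"
      unfolding dual_norm_def using bdd by (intro cSUP_upper) auto
    moreover have "\<bar>\<phi> g\<bar> = \<bar>\<phi> f\<bar> / n f"
      using pos by (simp add: g_def scale[OF assms(2)] abs_mult divide_inverse)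
    ultimately show ?thesis
      using pos by (simp add: field_simps)
  qed
qed

lemma dual_norm_least:
  assumes "\<And>f. f \<in> V \<Longrightarrow> \<bar>\<phi> f\<bar> \<le> K * n f" "K \<ge> 0"
  shows "dual_norm V n \<phi> \<le> K"
  unfolding dual_norm_def
proof (rule cSUP_least)
  show "{f \<in> V. n f \<le> 1} \<noteq> {}"
    using zero_mem norm_zero by auto
next
  fix f assume "f \<in> {f \<in> V. n f \<le> 1}"
  then show "\<bar>\<phi> f\<bar> \<le> K"
    using assms(1)[of f] mult_left_mono[of "n f" 1 K] assms(2) by auto
qed

lemma dual_norm_nonneg:
  assumes "\<phi> \<in> continuous_dual V n"
  shows "0 \<le> dual_norm V n \<phi>"
proof (cases "\<exists>f\<in>V. n f > 0")
  case True
  then obtain f where f: "f \<in> V" "n f > 0"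
    by blast
  then have "0 \<le> dual_norm V n \<phi> * n f"
    using dual_norm_upper[OF assms f(1)] by linarith
  then show ?thesis
    using f(2) by (simp add: zero_le_mult_iff)
next
  \<comment> \<open>All norms vanish, so V is {0} and the supremum is the single value
    \<open>\<bar>\<phi> 0\<bar>\<close>.\<close>
  case False
  then have "{f \<in> V. n f \<le> 1} = {0}"
    using definite norm_nonneg zero_mem norm_zero by force
  then show ?thesis
    by (simp add: dual_norm_def)
qed

lemma continuous_dualI:
  assumes "\<And>x y. \<lbrakk>x \<in> V; y \<in> V\<rbrakk> \<Longrightarrow> \<phi> (x + y) = \<phi> x + \<phi> y"
    and "\<And>c x. x \<in> V \<Longrightarrow> \<phi> (c *\<^sub>R x) = c * \<phi> x"
    and "\<And>x. x \<in> V \<Longrightarrow> \<bar>\<phi> x\<bar> \<le> K * n x"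
    and "\<And>x. x \<notin> V \<Longrightarrow> \<phi> x = 0"
  shows "\<phi> \<in> continuous_dual V n"
  using assms unfolding continuous_dual_def bounded_linear_on_def
  by (auto intro!: exI[of _ K])

lemma continuous_dualD:
  assumes "\<phi> \<in> continuous_dual V n"
  shows "\<lbrakk>x \<in> V; y \<in> V\<rbrakk> \<Longrightarrow> \<phi> (x + y) = \<phi> x + \<phi> y"
    and "x \<in> V \<Longrightarrow> \<phi> (c *\<^sub>R x) = c * \<phi> x"
    and "x \<notin> V \<Longrightarrow> \<phi> x = 0"
  using assms unfolding continuous_dual_def bounded_linear_on_def by auto

text \<open>The pointwise estimates \<open>add_le\<close> and \<open>scale_le\<close> serve twice:
  as the bounds that put sums and multiples into the dual, and as the norm inequalities
  themselves.\<close>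

lemma normed_carrier_dual: "normed_carrier (continuous_dual V n) (dual_norm V n)"
proof
  let ?D = "continuous_dual V n" and ?m = "dual_norm V n"
  have add_le: "\<bar>(\<phi> + \<psi>) f\<bar> \<le> (?m \<phi> + ?m \<psi>) * n f"
    if "\<phi> \<in> ?D" "\<psi> \<in> ?D" "f \<in> V" for \<phi> \<psi> f
    using dual_norm_upper[OF that(1,3)] dual_norm_upper[OF that(2,3)]
    by (simp add: distrib_right)
  have scale_le: "\<bar>(c *\<^sub>R \<phi>) f\<bar> \<le> (\<bar>c\<bar> * ?m \<phi>) * n f"
    if "\<phi> \<in> ?D" "f \<in> V" for \<phi> c f
    using mult_left_mono[OF dual_norm_upper[OF that], of "\<bar>c\<bar>"]
    by (simp add: scaleR_fun_def abs_mult mult.assoc)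
  show "subspace ?D"
  proof (rule subspaceI)
    show "0 \<in> ?D"
      by (rule continuous_dualI[where K = 0]) auto
  next
    fix \<phi> \<psi> assume D: "\<phi> \<in> ?D" "\<psi> \<in> ?D"
    show "\<phi> + \<psi> \<in> ?D"
      by (rule continuous_dualI[where K = "?m \<phi> + ?m \<psi>"])
        (use D add_le[OF D] in \<open>auto simp: continuous_dualD distrib_left\<close>)
  next
    fix \<phi> c assume D: "\<phi> \<in> ?D"
    show "c *\<^sub>R \<phi> \<in> ?D"
      by (rule continuous_dualI[where K = "\<bar>c\<bar> * ?m \<phi>"])
        (use D scale_le[OF D] in \<open>auto simp: continuous_dualD scaleR_fun_def distrib_left\<close>)
  qed
  show "?m (\<phi> + \<psi>) \<le> ?m \<phi> + ?m \<psi>" if "\<phi> \<in> ?D" "\<psi> \<in> ?D" for \<phi> \<psi>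
    using that by (intro dual_norm_least add_le add_nonneg_nonneg dual_norm_nonneg)
  show "?m (c *\<^sub>R \<phi>) \<le> \<bar>c\<bar> * ?m \<phi>" if "\<phi> \<in> ?D" for c \<phi>
    using that by (intro dual_norm_least scale_le mult_nonneg_nonneg dual_norm_nonneg) auto
  \<comment> \<open>Norm zero forces \<phi> to vanish on V; off V it vanishes by the normalisation
    of dual elements.\<close>
  show "\<phi> = 0" if "\<phi> \<in> ?D" "?m \<phi> = 0" for \<phi>
  proof
    fix f
    show "\<phi> f = 0 f"
      using dual_norm_upper[OF that(1), of f] continuous_dualD(3)[OF that(1), of f] that(2)
      by (cases "f \<in> V") auto
  qed
qed

end

section \<open>Banach space adjoints, cut off outside V to match the normalisation of dual
  elements\<close>

definition adjoint_on :: "'v set \<Rightarrow> ('v \<Rightarrow> 'w) \<Rightarrow> ('w \<Rightarrow> real) \<Rightarrow> 'v \<Rightarrow> real"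
  where "adjoint_on V A \<phi> = (\<lambda>f. if f \<in> V then \<phi> (A f) else 0)"

text \<open>Linearity on the whole function type makes the library facts on images of
  \<open>span\<close> applicable.\<close>

lemma linear_adjoint_on: "linear (adjoint_on V A)"
  by (rule linearI) (auto simp: adjoint_on_def scaleR_fun_def fun_eq_iff)

lemma bounded_linear_on_adjoint:
  assumes V: "normed_carrier V n" and W: "normed_carrier W m"
    and A: "bounded_linear_on V n W m A"
  shows "bounded_linear_on (continuous_dual W m) (dual_norm W m)
           (continuous_dual V n) (dual_norm V n) (adjoint_on V A)"
proof -
  interpret V: normed_carrier V n by fact
  interpret W: normed_carrier W m by fact
  obtain K where K: "K \<ge> 0" "\<And>f. f \<in> V \<Longrightarrow> m (A f) \<le> K * n f"
    using bounded_linear_on_bound_nonneg[OF V A] by blast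
  have AV: "A f \<in> W" if "f \<in> V" for f
    using A that unfolding bounded_linear_on_def by blast
  have bound: "\<bar>adjoint_on V A \<phi> f\<bar> \<le> (K * dual_norm W m \<phi>) * n f"
    if \<phi>: "\<phi> \<in> continuous_dual W m" and f: "f \<in> V" for \<phi> f
  proof -
    have "\<bar>adjoint_on V A \<phi> f\<bar> \<le> dual_norm W m \<phi> * m (A f)"
      using W.dual_norm_upper[OF \<phi> AV[OF f]] f by (simp add: adjoint_on_def)
    also have "\<dots> \<le> dual_norm W m \<phi> * (K * n f)"
      using K(2)[OF f] W.dual_norm_nonneg[OF \<phi>] by (rule mult_left_mono)
    finally show ?thesis
      by (simp add: mult_ac)
  qed
  have "adjoint_on V A \<phi> \<in> continuous_dual V n" if \<phi>: "\<phi> \<in> continuous_dual W m" for \<phi>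
  proof (rule V.continuous_dualI[OF _ _ bound[OF \<phi>]])
    fix x y assume "x \<in> V" "y \<in> V"
    then show "adjoint_on V A \<phi> (x + y) = adjoint_on V A \<phi> x + adjoint_on V A \<phi> y"
      using A AV W.continuous_dualD(1)[OF \<phi>] subspace_add[OF V.subspace]
      by (simp add: adjoint_on_def bounded_linear_on_def)
  next
    fix c x assume "x \<in> V"
    then show "adjoint_on V A \<phi> (c *\<^sub>R x) = c * adjoint_on V A \<phi> x"
      using A AV W.continuous_dualD(2)[OF \<phi>] subspace_scale[OF V.subspace]
      by (simp add: adjoint_on_def bounded_linear_on_def)
  qed (auto simp: adjoint_on_def)
  moreover have "dual_norm V n (adjoint_on V A \<phi>) \<le> K * dual_norm W m \<phi>"
    if "\<phi> \<in> continuous_dual W m" for \<phi>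
    using that K(1) by (intro V.dual_norm_least bound mult_nonneg_nonneg W.dual_norm_nonneg)
  ultimately show ?thesis
    unfolding bounded_linear_on_def
    by (metis linear_add[OF linear_adjoint_on] linear_scale[OF linear_adjoint_on])
qed

section \<open>Lipschitz functions and Lipschitz-free spaces\<close>

text \<open>The infimum is attained: every admissible constant bounds each difference quotient,
  hence so does their infimum.\<close>

lemma lipschitz_on_lip_const:
  assumes "f \<in> lip0 M p"
  shows "(lip_const M f)-lipschitz_on M f"
proof (rule lipschitz_onI)
  let ?L = "{C. C-lipschitz_on M f}"
  have ne: "?L \<noteq> {}"
    using assms by (auto simp: lip0_def)
  show "0 \<le> lip_const M f"
    unfolding lip_const_def using ne by (rule cInf_greatest) (auto dest: lipschitz_on_nonneg)
  fix x y assume xy: "x \<in> M" "y \<in> M"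
  show "dist (f x) (f y) \<le> lip_const M f * dist x y"
  proof (cases "x = y")
    case False
    have "dist (f x) (f y) / dist x y \<le> lip_const M f"
      unfolding lip_const_def using ne
      by (rule cInf_greatest) (use False xy in \<open>auto simp: field_simps dest: lipschitz_onD\<close>)
    then show ?thesis
      using False by (simp add: field_simps)
  qed simp
qed

lemma lip_const_le:
  assumes "C-lipschitz_on M f"
  shows "lip_const M f \<le> C"
  unfolding lip_const_def using assms
  by (intro cInf_lower bdd_belowI[of _ 0]) (auto dest: lipschitz_on_nonneg)

lemma lip_const_nonneg: "f \<in> lip0 M p \<Longrightarrow> 0 \<le> lip_const M f"
  using lipschitz_on_lip_const lipschitz_on_nonneg by blast

lemma lip0_diff_le:
  assumes "f \<in> lip0 M p" "x \<in> M" "y \<in> M"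
  shows "\<bar>f x - f y\<bar> \<le> lip_const M f * dist x y"
  using lipschitz_onD[OF lipschitz_on_lip_const[OF assms(1)] assms(2,3)] by (simp add: dist_real_def)

lemma lip0_abs_le:
  assumes "f \<in> lip0 M p" "x \<in> M" "p \<in> M"
  shows "\<bar>f x\<bar> \<le> lip_const M f * dist x p"
  using lip0_diff_le[OF assms] assms(1) by (simp add: lip0_def)

lemma lip0I:
  assumes "C \<ge> 0" "\<And>x y. \<lbrakk>x \<in> M; y \<in> M\<rbrakk> \<Longrightarrow> \<bar>f x - f y\<bar> \<le> C * dist x y"
    and "f p = 0" "\<And>x. x \<notin> M \<Longrightarrow> f x = 0"
  shows "f \<in> lip0 M p" and "lip_const M f \<le> C"
proof -
  have "C-lipschitz_on M f"
    using assms by (auto intro!: lipschitz_onI simp: dist_real_def)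
  then show "f \<in> lip0 M p" "lip_const M f \<le> C"
    using assms lip_const_le by (auto simp: lip0_def)
qed

text \<open>Definiteness comes from the base point: a function with Lipschitz constant 0 is constant
  on M, and its value at p is 0.\<close>

lemma normed_carrier_lip0:
  assumes p: "p \<in> M"
  shows "normed_carrier (lip0 M p) (lip_const M)"
proof
  have add: "f + g \<in> lip0 M p \<and> lip_const M (f + g) \<le> lip_const M f + lip_const M g"
    if f: "f \<in> lip0 M p" and g: "g \<in> lip0 M p" for f g
  proof -
    have "\<bar>(f + g) x - (f + g) y\<bar> \<le> (lip_const M f + lip_const M g) * dist x y"
      if "x \<in> M" "y \<in> M" for x y
      using lip0_diff_le[OF f that] lip0_diff_le[OF g that] by (simp add: distrib_right)
    moreover have "(f + g) p = 0" "\<And>x. x \<notin> M \<Longrightarrow> (f + g) x = 0"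
      using f g by (auto simp: lip0_def)
    ultimately show ?thesis
      using lip_const_nonneg[OF f] lip_const_nonneg[OF g]
      by (intro conjI lip0I[where C = "lip_const M f + lip_const M g"]) auto
  qed
  have scale: "c *\<^sub>R f \<in> lip0 M p \<and> lip_const M (c *\<^sub>R f) \<le> \<bar>c\<bar> * lip_const M f"
    if f: "f \<in> lip0 M p" for c f
  proof -
    have "\<bar>(c *\<^sub>R f) x - (c *\<^sub>R f) y\<bar> \<le> (\<bar>c\<bar> * lip_const M f) * dist x y"
      if "x \<in> M" "y \<in> M" for x y
      using mult_left_mono[OF lip0_diff_le[OF f that], of "\<bar>c\<bar>"]
      by (simp add: scaleR_fun_def abs_mult[symmetric] right_diff_distrib mult.assoc)
    moreover have "(c *\<^sub>R f) p = 0" "\<And>x. x \<notin> M \<Longrightarrow> (c *\<^sub>R f) x = 0"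
      using f by (auto simp: lip0_def scaleR_fun_def)
    ultimately show ?thesis
      using lip_const_nonneg[OF f]
      by (intro conjI lip0I[where C = "\<bar>c\<bar> * lip_const M f"]) auto
  qed
  have "(0 :: 'a \<Rightarrow> real) \<in> lip0 M p"
    by (rule lip0I(1)[where C = 0]) auto
  then show "subspace (lip0 M p)"
    using add scale by (simp add: subspace_def)
  show "lip_const M (f + g) \<le> lip_const M f + lip_const M g"
    if "f \<in> lip0 M p" "g \<in> lip0 M p" for f g
    using add that by blast
  show "lip_const M (c *\<^sub>R f) \<le> \<bar>c\<bar> * lip_const M f" if "f \<in> lip0 M p" for c f
    using scale that by blast
  show "f = 0" if f: "f \<in> lip0 M p" and "lip_const M f = 0" for f
  proof
    fix x
    show "f x = 0 x"
      using lip0_abs_le[OF f _ p, of x] that by (cases "x \<in> M") (auto simp: lip0_def)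
  qed
qed

section \<open>The free space inside the dual of \<open>lip0\<close>\<close>

lemma normed_carrier_lip0_dual:
  assumes "p \<in> M"
  shows "normed_carrier (continuous_dual (lip0 M p) (lip_const M)) (free_norm M p)"
  unfolding free_norm_def
  using normed_carrier.normed_carrier_dual[OF normed_carrier_lip0[OF assms]] .

lemma span_point_eval_subset:
  assumes p: "p \<in> M"
  shows "span (point_eval M p ` M) \<subseteq> continuous_dual (lip0 M p) (lip_const M)"
proof (rule span_minimal)
  interpret L: normed_carrier "lip0 M p" "lip_const M"
    using normed_carrier_lip0[OF p] .
  show "subspace (continuous_dual (lip0 M p) (lip_const M))"
    using normed_carrier.subspace[OF L.normed_carrier_dual] .
  show "point_eval M p ` M \<subseteq> continuous_dual (lip0 M p) (lip_const M)"
  proof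
    fix \<phi> assume "\<phi> \<in> point_eval M p ` M"
    then obtain x where x: "x \<in> M" "\<phi> = point_eval M p x"
      by blast
    \<comment> \<open>As f vanishes at p, the evaluation at x is bounded with constant
      \<open>dist x p\<close>.\<close>
    have "\<bar>f x\<bar> \<le> dist x p * lip_const M f" if "f \<in> lip0 M p" for f
      using lip0_abs_le[OF that x(1) p] by (simp add: mult.commute)
    then show "\<phi> \<in> continuous_dual (lip0 M p) (lip_const M)"
      unfolding x(2)
      using subspace_add[OF L.subspace] subspace_scale[OF L.subspace]
      by (intro L.continuous_dualI[where K = "dist x p"])
        (auto simp: point_eval_def scaleR_fun_def)
  qed
qed

lemma lipschitz_free_subset: "lipschitz_free M p \<subseteq> continuous_dual (lip0 M p) (lip_const M)"
  by (auto simp: lipschitz_free_def)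

text \<open>The free space is the closure of a subspace of the dual. Approximants are added or
  scaled, with tolerances e/2 and e/(|c|+1), where the 1 covers c = 0.\<close>

lemma normed_carrier_lipschitz_free:
  assumes p: "p \<in> M"
  shows "normed_carrier (lipschitz_free M p) (free_norm M p)"
proof -
  let ?D = "continuous_dual (lip0 M p) (lip_const M)" and ?S = "span (point_eval M p ` M)"
  interpret D: normed_carrier ?D "free_norm M p"
    using normed_carrier_lip0_dual[OF p] .
  have SD: "?S \<subseteq> ?D"
    using span_point_eval_subset[OF p] .
  have "subspace (lipschitz_free M p)"
  proof (rule subspaceI)
    show "0 \<in> lipschitz_free M p"
      using D.zero_mem D.norm_zero span_zero[of "point_eval M p ` M"]
      by (auto simp: lipschitz_free_def intro!: bexI[where x = 0])
  next
    fix \<phi> \<psi> assume F: "\<phi> \<in> lipschitz_free M p" "\<psi> \<in> lipschitz_free M p"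
    then have D: "\<phi> \<in> ?D" "\<psi> \<in> ?D"
      by (auto simp: lipschitz_free_def)
    have "\<exists>\<rho>\<in>?S. free_norm M p (\<phi> + \<psi> - \<rho>) < e" if "e > 0" for e
    proof -
      have "e / 2 > 0"
        using that by simp
      then obtain \<phi>' \<psi>' where a: "\<phi>' \<in> ?S" "free_norm M p (\<phi> - \<phi>') < e / 2"
        "\<psi>' \<in> ?S" "free_norm M p (\<psi> - \<psi>') < e / 2"
        using F unfolding lipschitz_free_def by blast
      have "\<phi> - \<phi>' \<in> ?D" "\<psi> - \<psi>' \<in> ?D"
        using D a SD by (auto intro: subspace_diff[OF D.subspace])
      from D.triangle[OF this] have "free_norm M p (\<phi> + \<psi> - (\<phi>' + \<psi>')) < e"
        using a by (simp add: add_diff_add)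
      then show ?thesis
        using span_add[OF a(1,3)] by blast
    qed
    then show "\<phi> + \<psi> \<in> lipschitz_free M p"
      using subspace_add[OF D.subspace D] by (simp add: lipschitz_free_def)
  next
    fix \<phi> c assume F: "\<phi> \<in> lipschitz_free M p"
    then have D: "\<phi> \<in> ?D"
      by (auto simp: lipschitz_free_def)
    have "\<exists>\<rho>\<in>?S. free_norm M p (c *\<^sub>R \<phi> - \<rho>) < e" if e: "e > 0" for e
    proof -
      have "e / (\<bar>c\<bar> + 1) > 0"
        using e by simp
      then obtain \<phi>' where a: "\<phi>' \<in> ?S" "free_norm M p (\<phi> - \<phi>') < e / (\<bar>c\<bar> + 1)"
        using F unfolding lipschitz_free_def by blast
      have d: "\<phi> - \<phi>' \<in> ?D"
        using D a SD by (auto intro: subspace_diff[OF D.subspace])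
      have "free_norm M p (c *\<^sub>R \<phi> - c *\<^sub>R \<phi>') \<le> \<bar>c\<bar> * free_norm M p (\<phi> - \<phi>')"
        using D.scale_le[OF d, of c] by (simp add: scaleR_diff_right)
      also have "\<dots> \<le> \<bar>c\<bar> * (e / (\<bar>c\<bar> + 1))"
        using a by (intro mult_left_mono) auto
      also have "\<dots> < e"
        using e by (simp add: field_simps)
      finally show ?thesis
        using span_scale[OF a(1)] by blast
    qed
    then show "c *\<^sub>R \<phi> \<in> lipschitz_free M p"
      using subspace_scale[OF D.subspace D] by (simp add: lipschitz_free_def)
  qed
  then show ?thesis
    using D.triangle D.scale_le D.definite lipschitz_free_subset[of M p]
    by unfold_locales blast+
qed

text \<open>The adjoint of A runs from the dual over N to the dual over M. By linearity and
  \<open>eval\<close> it maps the span of evaluations into the span of evaluations; by boundedness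
  it maps closure into closure.\<close>

lemma bounded_linear_on_adjoint_lipschitz_free:
  assumes p: "p \<in> M" and r: "r \<in> N"
    and A: "bounded_linear_on (lip0 M p) (lip_const M) (lip0 N r) (lip_const N) A"
    and eval: "\<And>x. x \<in> N \<Longrightarrow>
      adjoint_on (lip0 M p) A (point_eval N r x) \<in> span (point_eval M p ` M)"
  shows "bounded_linear_on (lipschitz_free N r) (free_norm N r)
           (lipschitz_free M p) (free_norm M p) (adjoint_on (lip0 M p) A)"
proof -
  let ?D = "continuous_dual (lip0 N r) (lip_const N)" and ?T = "adjoint_on (lip0 M p) A"
  interpret D: normed_carrier ?D "free_norm N r"
    using normed_carrier_lip0_dual[OF r] .
  have T: "bounded_linear_on ?D (free_norm N r)
      (continuous_dual (lip0 M p) (lip_const M)) (free_norm M p) ?T"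
    unfolding free_norm_def
    using bounded_linear_on_adjoint[OF normed_carrier_lip0[OF p] normed_carrier_lip0[OF r] A] .
  obtain K where K: "K \<ge> 0" "\<And>\<phi>. \<phi> \<in> ?D \<Longrightarrow> free_norm M p (?T \<phi>) \<le> K * free_norm N r \<phi>"
    using bounded_linear_on_bound_nonneg[OF D.normed_carrier_axioms T] by blast
  have span: "?T ` span (point_eval N r ` N) \<subseteq> span (point_eval M p ` M)"
    unfolding linear_span_image[OF linear_adjoint_on, symmetric]
    by (rule span_minimal) (use eval in auto)
  have "?T \<phi> \<in> lipschitz_free M p" if F: "\<phi> \<in> lipschitz_free N r" for \<phi>
  proof -
    have \<phi>: "\<phi> \<in> ?D"
      using F by (auto simp: lipschitz_free_def)
    have "\<exists>\<psi>\<in>span (point_eval M p ` M). free_norm M p (?T \<phi> - \<psi>) < e" if e: "e > 0" for e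
    proof -
      have "e / (K + 1) > 0"
        using e K(1) by simp
      then obtain \<phi>' where a: "\<phi>' \<in> span (point_eval N r ` N)"
        "free_norm N r (\<phi> - \<phi>') < e / (K + 1)"
        using F unfolding lipschitz_free_def by blast
      have d: "\<phi> - \<phi>' \<in> ?D"
        using \<phi> a(1) span_point_eval_subset[OF r] by (auto intro: subspace_diff[OF D.subspace])
      have "free_norm M p (?T \<phi> - ?T \<phi>') \<le> K * free_norm N r (\<phi> - \<phi>')"
        using K(2)[OF d] by (simp add: linear_diff[OF linear_adjoint_on])
      also have "\<dots> \<le> K * (e / (K + 1))"
        using a(2) K(1) by (intro mult_left_mono) auto
      also have "\<dots> < e"
        using e K(1) by (simp add: field_simps)
      finally show ?thesis
        using a(1) span by blast
    qed
    then show ?thesis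
      using T \<phi> by (auto simp: lipschitz_free_def bounded_linear_on_def)
  qed
  then show ?thesis
    using bounded_linear_on_restrict[OF bounded_linear_on_subset[OF T lipschitz_free_subset]]
    by blast
qed

section \<open>Restriction to the sphere and homogeneous extension\<close>

text \<open>Subtracting g r moves the zero to the new base point r and leaves differences on N
  unchanged.\<close>

definition restrict_lip0 :: "'a::metric_space set \<Rightarrow> 'a \<Rightarrow> ('a \<Rightarrow> real) \<Rightarrow> 'a \<Rightarrow> real"
  where "restrict_lip0 N r g = (\<lambda>x. if x \<in> N then g x - g r else 0)"

text \<open>The subtracted constant gives the value 0 at p. At x = 0 the factor
  \<open>norm x\<close> removes the term with \<open>sgn 0\<close>, which is not a point of the
  sphere.\<close>

definition homogeneous_ext :: "'a::real_normed_vector \<Rightarrow> ('a \<Rightarrow> real) \<Rightarrow> 'a \<Rightarrow> real"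
  where "homogeneous_ext p f = (\<lambda>x. norm x * f (sgn x) - norm p * f (sgn p))"

lemma bounded_linear_on_restrict_lip0:
  assumes "N \<subseteq> M" "r \<in> N"
  shows "bounded_linear_on (lip0 M p) (lip_const M) (lip0 N r) (lip_const N) (restrict_lip0 N r)"
proof -
  have "restrict_lip0 N r g \<in> lip0 N r \<and> lip_const N (restrict_lip0 N r g) \<le> 1 * lip_const M g"
    if g: "g \<in> lip0 M p" for g
    using lip0I[of "lip_const M g" N "restrict_lip0 N r g" r] lip_const_nonneg[OF g]
      lip0_diff_le[OF g] assms by (auto simp: restrict_lip0_def subset_iff)
  then show ?thesis
    unfolding bounded_linear_on_def
    by (auto simp: restrict_lip0_def fun_eq_iff scaleR_fun_def algebra_simps intro!: exI[of _ 1])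
qed

lemma norm_mult_dist_sgn_le:
  fixes x y :: "'a::real_normed_vector"
  assumes "x \<noteq> 0" "y \<noteq> 0"
  shows "norm y * dist (sgn x) (sgn y) \<le> 2 * dist x y"
proof -
  \<comment> \<open>Uses x = \<open>norm x *\<^sub>R sgn x\<close> and likewise for y. Each of the
    two summands has norm at most that of x - y, whence the factor 2.\<close>
  have "norm y *\<^sub>R (sgn x - sgn y) = (norm y - norm x) *\<^sub>R sgn x + (x - y)"
    using assms by (simp add: sgn_div_norm algebra_simps)
  then have "norm y * norm (sgn x - sgn y) \<le> \<bar>norm y - norm x\<bar> * norm (sgn x) + norm (x - y)"
    by (metis abs_norm_cancel norm_scaleR norm_triangle_ineq)
  also have "\<dots> \<le> 2 * norm (x - y)"
    using norm_triangle_ineq3[of y x] assms by (simp add: norm_sgn norm_minus_commute)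
  finally show ?thesis
    by (simp add: dist_norm)
qed

text \<open>With L the Lipschitz constant of f, the 4 is 2 + 2: varying the norm costs 2L because
  |f| is at most 2L on the sphere, and varying the direction costs 2L by
  \<open>norm_mult_dist_sgn_le\<close>.\<close>

lemma homogeneous_ext_lipschitz:
  fixes f :: "'a::real_normed_vector \<Rightarrow> real"
  assumes f: "f \<in> lip0 (sphere 0 1) q" and q: "q \<in> sphere 0 1"
  shows "\<bar>norm x * f (sgn x) - norm y * f (sgn y)\<bar> \<le> 4 * lip_const (sphere 0 1) f * dist x y"
proof -
  let ?L = "lip_const (sphere 0 1) f"
  have L: "?L \<ge> 0"
    using lip_const_nonneg[OF f] .
  have sgn: "sgn z \<in> sphere 0 1" if "z \<noteq> 0" for z :: 'a
    using that by (simp add: norm_sgn)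
  \<comment> \<open>Two points of the sphere are at distance at most 2, and f vanishes at q.\<close>
  have f_le: "\<bar>f (sgn z)\<bar> \<le> ?L * 2" if "z \<noteq> 0" for z
  proof -
    have "dist (sgn z) q \<le> norm (sgn z) + norm q"
      unfolding dist_norm by (rule norm_triangle_ineq4)
    then have "dist (sgn z) q \<le> 2"
      using sgn[OF that] q by simp
    then show ?thesis
      using lip0_abs_le[OF f sgn[OF that] q] mult_left_mono[OF _ L] by fastforce
  qed
  \<comment> \<open>This is the claim when one of the two points is the origin, where there is no
    direction to compare.\<close>
  have zero: "norm z * \<bar>f (sgn z)\<bar> \<le> 4 * ?L * norm z" for z
  proof (cases "z = 0")
    case False
    then have "norm z * \<bar>f (sgn z)\<bar> \<le> norm z * (?L * 2)"
      using f_le by (intro mult_left_mono) auto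
    also have "\<dots> \<le> 4 * ?L * norm z"
      using L by (simp add: mult_ac)
    finally show ?thesis .
  qed simp
  show ?thesis
  proof (cases "x = 0 \<or> y = 0")
    case True
    then show ?thesis
      using zero[of x] zero[of y] by (auto simp: abs_mult)
  next
    case False
    then have xy: "x \<noteq> 0" "y \<noteq> 0"
      by auto
    have "norm x * f (sgn x) - norm y * f (sgn y)
        = (norm x - norm y) * f (sgn x) + norm y * (f (sgn x) - f (sgn y))"
      by (simp add: algebra_simps)
    also have "\<bar>\<dots>\<bar> \<le> \<bar>norm x - norm y\<bar> * \<bar>f (sgn x)\<bar> + norm y * \<bar>f (sgn x) - f (sgn y)\<bar>"
      by (metis abs_mult abs_norm_cancel abs_triangle_ineq)
    also have "\<dots> \<le> dist x y * (?L * 2) + norm y * (?L * dist (sgn x) (sgn y))"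
      using norm_triangle_ineq3[of x y] f_le[OF xy(1)] lip0_diff_le[OF f sgn sgn, OF xy] L
      by (intro add_mono mult_mono) (auto simp: dist_norm)
    also have "\<dots> \<le> dist x y * (?L * 2) + ?L * (2 * dist x y)"
      using mult_left_mono[OF norm_mult_dist_sgn_le[OF xy] L] by (simp add: mult_ac)
    finally show ?thesis
      by (simp add: mult_ac)
  qed
qed

lemma bounded_linear_on_homogeneous_ext:
  fixes p q :: "'a::real_normed_vector"
  assumes q: "q \<in> sphere 0 1"
  shows "bounded_linear_on (lip0 (sphere 0 1) q) (lip_const (sphere 0 1))
           (lip0 UNIV p) (lip_const UNIV) (homogeneous_ext p)"
proof -
  have "homogeneous_ext p f \<in> lip0 UNIV p \<and>
      lip_const UNIV (homogeneous_ext p f) \<le> 4 * lip_const (sphere 0 1) f"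
    if f: "f \<in> lip0 (sphere 0 1) q" for f
    using lip0I[of "4 * lip_const (sphere 0 1) f" UNIV "homogeneous_ext p f" p]
      homogeneous_ext_lipschitz[OF f q] lip_const_nonneg[OF f]
    by (simp add: homogeneous_ext_def)
  then show ?thesis
    unfolding bounded_linear_on_def
    by (auto simp: homogeneous_ext_def fun_eq_iff scaleR_fun_def algebra_simps intro!: exI[of _ 4])
qed

text \<open>On the sphere \<open>norm x\<close> is 1 and \<open>sgn x\<close> is x, so the extension
  is f minus a constant; renormalising at q removes the constant because f q = 0.\<close>

lemma restrict_homogeneous_ext:
  fixes f :: "'a::real_normed_vector \<Rightarrow> real"
  assumes f: "f \<in> lip0 (sphere 0 1) q" and q: "q \<in> sphere 0 1"
  shows "restrict_lip0 (sphere 0 1) q (homogeneous_ext p f) = f"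
  using assms by (auto simp: restrict_lip0_def homogeneous_ext_def lip0_def sgn_div_norm)

theorem fact2p1:
  fixes p q :: "'a::banach"
  assumes infinite_dim: "\<And>B :: 'a set. finite B \<Longrightarrow> span B \<noteq> UNIV"
    and base: "q \<in> sphere 0 1"
  shows "\<exists>Y. complemented_subspace_of Y (lipschitz_free (UNIV :: 'a set) p) (free_norm UNIV p) \<and>
             isomorphic_normed (lipschitz_free (sphere 0 1) q) (free_norm (sphere 0 1) q)
                               Y (free_norm UNIV p)"
proof -
  let ?S = "sphere 0 1 :: 'a set"
  let ?R = "restrict_lip0 ?S q" and ?E = "homogeneous_ext p"
  let ?T = "adjoint_on (lip0 UNIV p) ?R" and ?Q = "adjoint_on (lip0 ?S q) ?E"
  have R: "bounded_linear_on (lip0 UNIV p) (lip_const UNIV) (lip0 ?S q) (lip_const ?S) ?R"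
    using bounded_linear_on_restrict_lip0[OF subset_UNIV base] .
  have E: "bounded_linear_on (lip0 ?S q) (lip_const ?S) (lip0 UNIV p) (lip_const UNIV) ?E"
    using bounded_linear_on_homogeneous_ext[OF base] .
  have R_mem: "?R g \<in> lip0 ?S q" if "g \<in> lip0 UNIV p" for g
    using R that unfolding bounded_linear_on_def by blast
  have E_mem: "?E f \<in> lip0 UNIV p" if "f \<in> lip0 ?S q" for f
    using E that unfolding bounded_linear_on_def by blast
  \<comment> \<open>The second evaluation reflects the constant g q subtracted by the
    restriction.\<close>
  have "?T (point_eval ?S q x) = point_eval UNIV p x - point_eval UNIV p q" if "x \<in> ?S" for x
    using that R_mem by (auto simp: adjoint_on_def point_eval_def restrict_lip0_def fun_eq_iff)
  then have T: "bounded_linear_on (lipschitz_free ?S q) (free_norm ?S q)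
      (lipschitz_free UNIV p) (free_norm UNIV p) ?T"
    by (intro bounded_linear_on_adjoint_lipschitz_free R base) (auto intro: span_diff span_base)
  \<comment> \<open>For x = 0 the point \<open>sgn x\<close> is off the sphere, but the coefficient
    is 0.\<close>
  have scaled: "norm x *\<^sub>R point_eval ?S q (sgn x) \<in> span (point_eval ?S q ` ?S)" for x
  proof (cases "x = 0")
    case False
    then show ?thesis
      by (intro span_scale span_base imageI) (simp add: norm_sgn)
  qed (simp add: span_zero)
  \<comment> \<open>The term in p comes from the constant that makes the extension vanish at
    p.\<close>
  have "?Q (point_eval UNIV p x)
      = norm x *\<^sub>R point_eval ?S q (sgn x) - norm p *\<^sub>R point_eval ?S q (sgn p)" for x
    using E_mem
    by (auto simp: adjoint_on_def point_eval_def homogeneous_ext_def fun_eq_iff scaleR_fun_def)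
  then have Q: "bounded_linear_on (lipschitz_free UNIV p) (free_norm UNIV p)
      (lipschitz_free ?S q) (free_norm ?S q) ?Q"
    by (intro bounded_linear_on_adjoint_lipschitz_free E base) (auto intro: span_diff scaled)
  \<comment> \<open>On \<open>lip0 ?S q\<close> the left side is \<phi> applied to restriction after
    extension, which is the identity there; elsewhere both sides are 0 by normalisation.\<close>
  have "?Q (?T \<phi>) = \<phi>" if "\<phi> \<in> lipschitz_free ?S q" for \<phi>
  proof
    fix f
    have "\<phi> f = 0" if "f \<notin> lip0 ?S q"
      using that \<open>\<phi> \<in> _\<close> by (auto simp: lipschitz_free_def continuous_dual_def)
    then show "?Q (?T \<phi>) f = \<phi> f"
      using restrict_homogeneous_ext[OF _ base] E_mem by (auto simp: adjoint_on_def)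
  qed
  then show ?thesis
    using complemented_of_left_inverse[OF normed_carrier_lipschitz_free[OF base]
        normed_carrier_lipschitz_free[OF UNIV_I] T Q] by blast
qed

end
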